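(* For any $\delta>0$, let $N(\delta)=\left\lceil \log_2\left(\frac1\delta+1\right)\right\rceil$. Then for all $n\ge N(\delta)$, for any nonempty $\gamma_1\subset\{1,2,\dots,n\}$, and for any subset $S$ of $\{0,1\}^{n^2}$ with $|S|\ge\delta\cdot 2^{n^2}$, there exist two elements $s_1,s_2\in S$ such that their difference set is of the form $\gamma_1\times\gamma_2$, where $\gamma_2\subset\{1,2,\dots,n\}$ is a nonempty subset.
   Context: Elements of $\{0,1\}^{n^2}$ are $0/1$ fillings of the $n\times n$ grid $\{1,\dots,n\}\times\{1,\dots,n\}$. The difference set of two elements $s_1,s_2$ is the set of grid points $(i,j)$ at which $s_1$ and $s_2$ differ. *)

theory Defs
  imports Complex_Main "HOL-Library.FuncSet"
begin

definition grid :: "nat \<Rightarrow> (nat \<times> nat) set" where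
  "grid n = {1..n} \<times> {1..n}"

text \<open>Extensional functions, so that \<open>card (fillings n) = 2 ^ n\<^sup>2\<close>.\<close>

definition fillings :: "nat \<Rightarrow> (nat \<times> nat \<Rightarrow> nat) set" where
  "fillings n = grid n \<rightarrow>\<^sub>E {0, 1}"

definition difference_set ::
    "nat \<Rightarrow> (nat \<times> nat \<Rightarrow> nat) \<Rightarrow> (nat \<times> nat \<Rightarrow> nat) \<Rightarrow> (nat \<times> nat) set" where
  "difference_set n s1 s2 = {p \<in> grid n. s1 p \<noteq> s2 p}"

definition N :: "real \<Rightarrow> int" where
  "N \<delta> = \<lceil>log 2 (1 / \<delta> + 1)\<rceil>"

end

theory Submission
  imports Defs
begin

text \<open>
  Regard fillings as vectors over the field with two elements. The indicators of the sets
  \<open>\<gamma>1 \<times> \<gamma>2\<close>, with \<open>\<gamma>2 \<subseteq> {1..n}\<close>, form a subspace with \<open>2 ^ n\<close> elements, and two fillings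
  differ exactly on some \<open>\<gamma>1 \<times> \<gamma>2\<close> iff they lie in the same coset of it. There are only
  \<open>2 ^ (n\<^sup>2 - n)\<close> cosets, so a set of fillings of density above \<open>2 ^ -n\<close> contains two distinct
  elements of one coset; \<open>n \<ge> N \<delta>\<close> makes \<open>\<delta>\<close> exceed that density
  (\<open>density_above_coset_threshold\<close>).

  To count the cosets, fix a row index \<open>a \<in> \<gamma>1\<close>. Each coset has exactly one member that vanishes
  on row \<open>a\<close>, obtained by adding row \<open>a\<close> to every row with index in \<open>\<gamma>1\<close>. What is left of it
  outside row \<open>a\<close> is a \<open>0/1\<close> filling of \<open>n\<^sup>2 - n\<close> cells (\<open>coset_code\<close>), and it determines the
  coset (\<open>difference_set_if_coset_code_eq\<close>).
\<close>

text \<open>Addition modulo 2 of two entries is written as the test whether they differ, which suits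
  the case distinctions on differing entries.\<close>

definition coset_code ::
    "nat \<Rightarrow> nat set \<Rightarrow> nat \<Rightarrow> (nat \<times> nat \<Rightarrow> nat) \<Rightarrow> nat \<times> nat \<Rightarrow> nat" where
  "coset_code n \<gamma> a s =
    (\<lambda>p \<in> grid n - {a} \<times> {1..n}.
      if fst p \<in> \<gamma> then (if s p = s (a, snd p) then 0 else 1) else s p)"

lemma fillings_values:
  assumes "s \<in> fillings n" and "p \<in> grid n"
  shows "s p = 0 \<or> s p = 1"
  using assms unfolding fillings_def by (auto dest: PiE_mem)

lemma coset_code_in:
  assumes "s \<in> fillings n"
  shows "coset_code n \<gamma> a s \<in> (grid n - {a} \<times> {1..n}) \<rightarrow>\<^sub>E {0, 1}"
  unfolding coset_code_def using fillings_values[OF assms] by auto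

lemma card_codes:
  assumes "a \<in> {1..n}"
  shows "card ((grid n - {a} \<times> {1..n}) \<rightarrow>\<^sub>E {0, 1 :: nat}) = 2 ^ (n\<^sup>2 - n)"
proof -
  have "card (grid n - {a} \<times> {1..n}) = card (grid n) - card ({a} \<times> {1..n})"
    using assms by (intro card_Diff_subset) (auto simp: grid_def)
  then have "card (grid n - {a} \<times> {1..n}) = n\<^sup>2 - n"
    by (simp add: grid_def card_cartesian_product power2_eq_square)
  moreover have "finite (grid n - {a} \<times> {1..n})"
    by (simp add: grid_def)
  ultimately show ?thesis
    by (simp add: card_PiE numeral_2_eq_2)
qed

text \<open>For \<open>i \<in> \<gamma>\<close>, the code records whether the entries at \<open>(i, j)\<close> and \<open>(a, j)\<close> agree. With
  only two possible values, equal codes therefore force \<open>s1\<close> and \<open>s2\<close> to differ at \<open>(i, j)\<close>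
  exactly when they differ at \<open>(a, j)\<close>.\<close>

lemma difference_set_if_coset_code_eq:
  assumes s1: "s1 \<in> fillings n" and s2: "s2 \<in> fillings n"
    and a: "a \<in> \<gamma>" and \<gamma>: "\<gamma> \<subseteq> {1..n}"
    and eq: "coset_code n \<gamma> a s1 = coset_code n \<gamma> a s2"
  shows "difference_set n s1 s2 = \<gamma> \<times> {j \<in> {1..n}. s1 (a, j) \<noteq> s2 (a, j)}"
proof -
  have diff: "s1 (i, j) \<noteq> s2 (i, j) \<longleftrightarrow> i \<in> \<gamma> \<and> s1 (a, j) \<noteq> s2 (a, j)"
    if i: "i \<in> {1..n}" and j: "j \<in> {1..n}" for i j
  proof (cases "i = a")
    case True
    then show ?thesis using a by simp
  next
    case False
    have "(i, j) \<in> grid n" and "(a, j) \<in> grid n"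
      using i j a \<gamma> by (auto simp: grid_def)
    then have bits: "s1 (i, j) = 0 \<or> s1 (i, j) = 1" "s2 (i, j) = 0 \<or> s2 (i, j) = 1"
        "s1 (a, j) = 0 \<or> s1 (a, j) = 1" "s2 (a, j) = 0 \<or> s2 (a, j) = 1"
      using fillings_values[OF s1] fillings_values[OF s2] by blast+
    have code: "coset_code n \<gamma> a s (i, j) =
        (if i \<in> \<gamma> then (if s (i, j) = s (a, j) then 0 else 1) else s (i, j))" for s
      using False \<open>(i, j) \<in> grid n\<close> by (simp add: coset_code_def)
    have "coset_code n \<gamma> a s1 (i, j) = coset_code n \<gamma> a s2 (i, j)"
      by (simp add: eq)
    then show ?thesis
      using bits unfolding code by (cases "i \<in> \<gamma>") (simp_all, metis zero_neq_one)
  qed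
  show ?thesis
    unfolding difference_set_def grid_def using diff \<gamma> by blast
qed

text \<open>Since \<open>card S \<ge> \<delta> * 2 ^ n * 2 ^ (n\<^sup>2 - n)\<close>, the factor \<open>\<delta> * 2 ^ n\<close> bounds from below the
  average number of elements of \<open>S\<close> in a coset. The definition of \<open>N\<close> gives \<open>2 ^ n \<ge> 1 / \<delta> + 1\<close>,
  and the summand \<open>1\<close> makes the inequality strict.\<close>

lemma density_above_coset_threshold:
  assumes "\<delta> > 0" and "int n \<ge> N \<delta>"
  shows "\<delta> * 2 ^ n > 1"
proof -
  have "log 2 (1 / \<delta> + 1) \<le> real n"
    using assms(2) unfolding N_def by linarith
  then have "1 / \<delta> + 1 \<le> 2 ^ n"
    using \<open>\<delta> > 0\<close> by (simp add: log_le_iff powr_realpow add_pos_pos)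
  then have "1 / \<delta> < 2 ^ n"
    by linarith
  then show ?thesis
    using \<open>\<delta> > 0\<close> by (simp add: field_simps)
qed

theorem theorem7:
  fixes \<delta> :: real and n :: nat and \<gamma>1 :: "nat set"
    and S :: "(nat \<times> nat \<Rightarrow> nat) set"
  assumes "\<delta> > 0"
    and "int n \<ge> N \<delta>"
    and "\<gamma>1 \<subseteq> {1..n}" and "\<gamma>1 \<noteq> {}"
    and "S \<subseteq> fillings n"
    and "real (card S) \<ge> \<delta> * 2 ^ (n\<^sup>2)"
  shows "\<exists>s1\<in>S. \<exists>s2\<in>S. \<exists>\<gamma>2. \<gamma>2 \<subseteq> {1..n} \<and> \<gamma>2 \<noteq> {} \<and>
    difference_set n s1 s2 = \<gamma>1 \<times> \<gamma>2"
proof -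
  obtain a where a: "a \<in> \<gamma>1"
    using \<open>\<gamma>1 \<noteq> {}\<close> by blast
  then have a_n: "a \<in> {1..n}"
    using \<open>\<gamma>1 \<subseteq> {1..n}\<close> by blast
  let ?C = "(grid n - {a} \<times> {1..n}) \<rightarrow>\<^sub>E {0, 1 :: nat}"
  have "(2::real) ^ (n\<^sup>2) = 2 ^ n * 2 ^ (n\<^sup>2 - n)"
    by (simp add: power2_eq_square flip: power_add)
  then have "\<delta> * 2 ^ (n\<^sup>2) = (\<delta> * 2 ^ n) * 2 ^ (n\<^sup>2 - n)"
    by simp
  also have "\<dots> > 1 * 2 ^ (n\<^sup>2 - n)"
    using density_above_coset_threshold[OF assms(1,2)]
    by (intro mult_strict_right_mono) simp_all
  finally have "real (2 ^ (n\<^sup>2 - n)) < real (card S)"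
    using assms(6) unfolding of_nat_power of_nat_numeral by linarith
  then have "card ?C < card S"
    unfolding card_codes[OF a_n] by (simp only: of_nat_less_iff)
  moreover have "coset_code n \<gamma>1 a ` S \<subseteq> ?C"
    by (intro image_subsetI coset_code_in subsetD[OF assms(5)])
  moreover have "finite ?C"
    by (intro finite_PiE) (simp_all add: grid_def)
  ultimately have "\<not> inj_on (coset_code n \<gamma>1 a) S"
    using card_inj_on_le[of "coset_code n \<gamma>1 a" S ?C] by linarith
  then obtain s1 s2 where s: "s1 \<in> S" "s2 \<in> S" "s1 \<noteq> s2"
    and eq: "coset_code n \<gamma>1 a s1 = coset_code n \<gamma>1 a s2"
    unfolding inj_on_def by blast
  have fill: "s1 \<in> fillings n" "s2 \<in> fillings n"
    using s assms(5) by auto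
  define \<gamma>2 where "\<gamma>2 = {j \<in> {1..n}. s1 (a, j) \<noteq> s2 (a, j)}"
  have D: "difference_set n s1 s2 = \<gamma>1 \<times> \<gamma>2"
    unfolding \<gamma>2_def
    using difference_set_if_coset_code_eq[OF fill a assms(3) eq] .
  have "difference_set n s1 s2 \<noteq> {}"
  proof
    assume "difference_set n s1 s2 = {}"
    then have "s1 p = s2 p" if "p \<in> grid n" for p
      using that unfolding difference_set_def by blast
    then have "s1 = s2"
      by (rule PiE_ext[OF fill[unfolded fillings_def]])
    with s(3) show False ..
  qed
  then have "\<gamma>2 \<noteq> {}"
    using D by auto
  moreover have "\<gamma>2 \<subseteq> {1..n}"
    by (auto simp: \<gamma>2_def)
  ultimately show ?thesis
    using s D by blast
qed

end
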